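(* Let $n=(n_x:x\in J_L)$ be an $\ell$-way contingency table with marginalization function $n(\cdot)$ and let $1\leq d\leq\ell$. Then $$\min\big(n(\{j_1,\dots,j_d\}) : 1\leq j_1<\cdots<j_d\leq\ell\big)\;\geq\; n(\{1,\dots,\ell\})$$ and $$n(\{1,\dots,\ell\})\;\geq\;\max\left(\frac{1}{\binom{\ell-1}{d-1}}\sum_{1\leq j_1<\cdots<j_d\leq\ell} n(\{j_1,\dots,j_d\})-\left(\frac{\binom{\ell}{d}}{\binom{\ell-1}{d-1}}-1\right)n(\emptyset),\;0\right),$$ where the inequalities are understood cellwise, i.e., for every $x\in J_L$.
   Context: Let $L=\{1,\dots,\ell\}$. For each $j\in L$ let $I_j$ be a discrete (finite or countable) set of labels, and put $J_L=I_1\times\cdots\times I_\ell$. For $a=\{i_1,\dots,i_p\}\subset L$ put $J_a=I_{i_1}\times\cdots\times I_{i_p}$; each $x\in J_L$ is written $x=(x_a,x_{L\setminus a})$ with $x_a\in J_a$, $x_{L\setminus a}\in J_{L\setminus a}$. An $\ell$-way contingency table is a family $n=(n_x:x\in J_L)$ of non-negative real numbers (typically counts) with finite total sum. The marginalization function assigns to $a\subset L$ the marginal table $n(a)=(n_{x(a),+}: x_a\in J_a)$, where $n_{x(a),+}=\sum_{y\in J_{L\setminus a}} n_{(x_a,y)}$ is obtained by summing over all coordinates outside $a$. In particular $n(\{1,\dots,\ell\})=n$ is the table itself and $n(\emptyset)=\sum_{x\in J_L} n_x$ is the total. Convention: indices are omitted in a statement that holds for all choices of indices. An inequality among the marginal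 tables $n(a)$, for various $a$, means that for every fixed $x\in J_L$ the inequality holds with each $n(a)$ replaced by the number $n_{x(a),+}$. *)

theory Defs
  imports "HOL-Analysis.Analysis"
begin

(* I j is the set of labels of the j-th classification; all label sets live in one common type. *)
definition cells :: "(nat \<Rightarrow> 'i set) \<Rightarrow> nat set \<Rightarrow> (nat \<Rightarrow> 'i) set" where
  "cells I a = (\<Pi>\<^sub>E j\<in>a. I j)"

definition contingency_table :: "nat \<Rightarrow> (nat \<Rightarrow> 'i set) \<Rightarrow> ((nat \<Rightarrow> 'i) \<Rightarrow> real) \<Rightarrow> bool" where
  "contingency_table l I n \<longleftrightarrow>
     (\<forall>x\<in>cells I {1..l}. 0 \<le> n x) \<and> n summable_on cells I {1..l}"

(* The argument z is a cell of the marginal table, i.e. an element of cells I a;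
   merge reassembles the full index (z, y) from its two parts. *)
definition marginal ::
  "nat \<Rightarrow> (nat \<Rightarrow> 'i set) \<Rightarrow> ((nat \<Rightarrow> 'i) \<Rightarrow> real) \<Rightarrow> nat set \<Rightarrow> (nat \<Rightarrow> 'i) \<Rightarrow> real" where
  "marginal l I n a z =
     (\<Sum>\<^sub>\<infinity>y\<in>cells I ({1..l} - a). n (merge a ({1..l} - a) (z, y)))"

lemma marginal_full:
  assumes "x \<in> cells I {1..l}"
  shows "marginal l I n {1..l} (restrict x {1..l}) = n x"
proof -
  have "merge {1..l} {} (restrict x {1..l}, \<lambda>_. undefined) = x"
    using assms by (auto simp: cells_def merge_def fun_eq_iff PiE_def extensional_def)
  then show ?thesis
    by (simp add: marginal_def cells_def)
qed

lemma marginal_empty: "marginal l I n {} z = (\<Sum>\<^sub>\<infinity>x\<in>cells I {1..l}. n x)"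
  unfolding marginal_def
  by (rule infsum_cong_neutral)
     (auto simp: cells_def merge_def PiE_def extensional_def fun_eq_iff intro!: arg_cong[where f = n])

end

theory Submission
  imports Defs
begin

text \<open>The marginal \<open>n(a)\<close> at \<open>x\<close> is the mass of the cells agreeing with \<open>x\<close> on \<open>a\<close>. This set of
  cells contains \<open>x\<close>, which gives the upper bound on \<open>n x\<close>. Any other cell agrees with \<open>x\<close> on at most
  \<open>l - 1\<close> coordinates, hence is counted in at most \<open>(l - 1) choose d\<close> of the \<open>d\<close>-dimensional
  marginals, while \<open>x\<close> is counted in all \<open>l choose d\<close> of them. By Pascal's rule the sum of the
  \<open>d\<close>-dimensional marginals is therefore at most
  \<open>((l - 1) choose (d - 1)) * n x + ((l - 1) choose d) * n(\<emptyset>)\<close>.\<close>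

text \<open>A cell agreeing with \<open>x\<close> on \<open>a\<close> is determined by its
  coordinates in \<open>L - a\<close>, so restriction to \<open>L - a\<close> is the inverse. This
  moves every marginal to a sum over full cells, where different \<open>a\<close> can be
  compared.\<close>

lemma bij_betw_merge_cells:
  assumes x: "x \<in> cells I L" and a: "a \<subseteq> L"
  shows "bij_betw (\<lambda>y. merge a (L - a) (restrict x a, y)) (cells I (L - a))
           {y \<in> cells I L. \<forall>j\<in>a. y j = x j}"
proof (rule bij_betw_byWitness[where f' = "\<lambda>y. restrict y (L - a)"])
  show "\<forall>y\<in>cells I (L - a). restrict (merge a (L - a) (restrict x a, y)) (L - a) = y"
    by (auto simp: cells_def merge_def fun_eq_iff PiE_def extensional_def)
  show "\<forall>y\<in>{y \<in> cells I L. \<forall>j\<in>a. y j = x j}.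
          merge a (L - a) (restrict x a, restrict y (L - a)) = y"
    using a by (auto simp: cells_def merge_def fun_eq_iff PiE_def extensional_def)
  show "(\<lambda>y. merge a (L - a) (restrict x a, y)) ` cells I (L - a)
          \<subseteq> {y \<in> cells I L. \<forall>j\<in>a. y j = x j}"
    using x a by (auto simp: cells_def merge_def PiE_def extensional_def Pi_def)
  show "(\<lambda>y. restrict y (L - a)) ` {y \<in> cells I L. \<forall>j\<in>a. y j = x j} \<subseteq> cells I (L - a)"
    by (auto simp: cells_def)
qed

lemma marginal_eq_infsum_agreeing:
  assumes "x \<in> cells I {1..l}" "a \<subseteq> {1..l}"
  shows "marginal l I n a (restrict x a) = infsum n {y \<in> cells I {1..l}. \<forall>j\<in>a. y j = x j}"
  unfolding marginal_def by (rule infsum_reindex_bij_betw[OF bij_betw_merge_cells[OF assms]])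

lemma cell_le_marginal:
  assumes "contingency_table l I n" "x \<in> cells I {1..l}" "a \<subseteq> {1..l}"
  shows "n x \<le> marginal l I n a (restrict x a)"
proof -
  let ?S = "{y \<in> cells I {1..l}. \<forall>j\<in>a. y j = x j}"
  have "n summable_on ?S"
    using assms(1) by (auto simp: contingency_table_def intro: summable_on_subset_banach)
  \<comment> \<open>The cells of \<open>?S\<close> other than \<open>x\<close> contribute
    nonnegative terms.\<close>
  then have "infsum n {x} \<le> infsum n ?S"
    using assms by (intro infsum_mono_neutral) (auto simp: contingency_table_def)
  then show ?thesis
    using assms by (simp add: marginal_eq_infsum_agreeing)
qed

text \<open>If \<open>y\<close> and \<open>x\<close> differ at \<open>j\<close>, every counted
  \<open>a\<close> avoids \<open>j\<close>; if \<open>y = x\<close>, all \<open>d\<close>-subsets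
  count and Pascal's rule splits their number. Stating both cases as one bound gives the coefficient
  of \<open>n y\<close> for every cell at once.\<close>

lemma card_agreeing_subsets_le:
  assumes x: "x \<in> cells I {1..l}" and y: "y \<in> cells I {1..l}" and "1 \<le> d" "d \<le> l"
  shows "card {a. a \<subseteq> {1..l} \<and> card a = d \<and> (\<forall>j\<in>a. y j = x j)}
           \<le> ((l - 1) choose d) + (if y = x then (l - 1) choose (d - 1) else 0)"
proof (cases "y = x")
  case True
  then show ?thesis
    using assms choose_reduce_nat[of l d] n_subsets[of "{1..l}" d] by simp
next
  case False
  \<comment> \<open>Cells are extensional, so distinct cells already differ at an index inside
    \<open>{1..l}\<close>.\<close>
  then obtain j where j: "j \<in> {1..l}" "y j \<noteq> x j"
    using x y unfolding cells_def by (meson PiE_ext)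
  have "card {a. a \<subseteq> {1..l} \<and> card a = d \<and> (\<forall>j\<in>a. y j = x j)}
          \<le> card {a. a \<subseteq> {1..l} - {j} \<and> card a = d}"
    using j by (intro card_mono) auto
  also have "\<dots> = (l - 1) choose d"
    using n_subsets[of "{1..l} - {j}" d] j by simp
  finally show ?thesis by simp
qed

lemma sum_marginals_le:
  assumes ct: "contingency_table l I n" and x: "x \<in> cells I {1..l}" and d: "1 \<le> d" "d \<le> l"
  shows "(\<Sum>a | a \<subseteq> {1..l} \<and> card a = d. marginal l I n a (restrict x a))
           \<le> real ((l - 1) choose (d - 1)) * n x
             + real ((l - 1) choose d) * marginal l I n {} (restrict x {})"
proof -
  define C where "C = cells I {1..l}"
  define D where "D = {a. a \<subseteq> {1..l} \<and> card a = d}"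
  define S where "S a = {y \<in> C. \<forall>j\<in>a. y j = x j}" for a
  have nonneg: "n y \<ge> 0" if "y \<in> C" for y
    using ct that by (simp add: contingency_table_def C_def)
  have summable: "n summable_on C"
    using ct by (simp add: contingency_table_def C_def)
  have finD: "finite D"
    unfolding D_def by (rule finite_subset[of _ "Pow {1..l}"]) auto
  have point: "((\<lambda>y. if y = x then n y else 0) has_sum n x) C"
    by (rule iffD1[OF has_sum_cong_neutral has_sum_finite[of "{x}" n, simplified]])
       (use x in \<open>auto simp: C_def\<close>)
  \<comment> \<open>Extension by zero gives all marginals the common index set
    \<open>C\<close>.\<close>
  have marg: "((\<lambda>y. if y \<in> S a then n y else 0) has_sum infsum n (S a)) C" for a
  proof -
    have "(n has_sum infsum n (S a)) (S a)"
      by (intro has_sum_infsum summable_on_subset_banach[OF summable]) (auto simp: S_def)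
    then show ?thesis
      by (rule iffD1[OF has_sum_cong_neutral, rotated -1]) (auto simp: S_def)
  qed
  \<comment> \<open>Double counting: since \<open>D\<close> is finite, the sum over \<open>a\<close>
    moves inside the sum over cells.\<close>
  have lhs: "((\<lambda>y. \<Sum>a\<in>D. if y \<in> S a then n y else 0) has_sum (\<Sum>a\<in>D. infsum n (S a))) C"
    using finD by (induction D rule: finite_induct) (simp_all add: has_sum_add marg)
  have rhs: "((\<lambda>y. real ((l - 1) choose (d - 1)) * (if y = x then n y else 0)
                  + real ((l - 1) choose d) * n y)
       has_sum (real ((l - 1) choose (d - 1)) * n x + real ((l - 1) choose d) * infsum n C)) C"
    by (intro has_sum_add has_sum_cmult_right point has_sum_infsum summable)
  have "(\<Sum>a\<in>D. infsum n (S a))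
          \<le> real ((l - 1) choose (d - 1)) * n x + real ((l - 1) choose d) * infsum n C"
  \<comment> \<open>It remains to compare the coefficients of \<open>n y\<close> cell by
    cell.\<close>
  proof (rule has_sum_mono[OF lhs rhs])
    fix y assume y: "y \<in> C"
    have "(\<Sum>a\<in>D. if y \<in> S a then n y else 0) = real (card {a \<in> D. y \<in> S a}) * n y"
      using finD by (simp add: sum.If_cases Int_def)
    also have "{a \<in> D. y \<in> S a} = {a. a \<subseteq> {1..l} \<and> card a = d \<and> (\<forall>j\<in>a. y j = x j)}"
      using y by (auto simp: D_def S_def)
    also have "real (card \<dots>) * n y
        \<le> real (((l - 1) choose d) + (if y = x then (l - 1) choose (d - 1) else 0)) * n y"
      using card_agreeing_subsets_le[OF x _ d] y nonneg
      by (intro mult_right_mono) (simp_all only: C_def of_nat_le_iff)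
    finally show "(\<Sum>a\<in>D. if y \<in> S a then n y else 0)
        \<le> real ((l - 1) choose (d - 1)) * (if y = x then n y else 0)
          + real ((l - 1) choose d) * n y"
      by (simp add: algebra_simps split: if_splits)
  qed
  moreover have "(\<Sum>a\<in>D. infsum n (S a)) = (\<Sum>a\<in>D. marginal l I n a (restrict x a))"
    by (intro sum.cong) (simp_all add: D_def S_def C_def marginal_eq_infsum_agreeing[OF x])
  ultimately show ?thesis
    by (simp add: D_def C_def marginal_empty)
qed

theorem corollary3p2:
  fixes l d :: nat
    and I :: "nat \<Rightarrow> 'i set"
    and n :: "(nat \<Rightarrow> 'i) \<Rightarrow> real"
  assumes "\<forall>j\<in>{1..l}. countable (I j)"
    and "contingency_table l I n"
    and "1 \<le> d" and "d \<le> l"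
  shows "\<forall>x\<in>cells I {1..l}.
      Min ((\<lambda>a. marginal l I n a (restrict x a)) ` {a. a \<subseteq> {1..l} \<and> card a = d})
        \<ge> marginal l I n {1..l} (restrict x {1..l})
    \<and> marginal l I n {1..l} (restrict x {1..l})
        \<ge> max (1 / real ((l - 1) choose (d - 1))
                  * (\<Sum>a | a \<subseteq> {1..l} \<and> card a = d. marginal l I n a (restrict x a))
                - (real (l choose d) / real ((l - 1) choose (d - 1)) - 1)
                  * marginal l I n {} (restrict x {}))
              0"
proof (intro ballI conjI)
  note ct = assms(2)
  fix x assume x: "x \<in> cells I {1..l}"
  let ?D = "{a. a \<subseteq> {1..l} \<and> card a = d}"
  let ?K = "real ((l - 1) choose (d - 1))"
  let ?sum = "\<Sum>a\<in>?D. marginal l I n a (restrict x a)"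
  let ?total = "marginal l I n {} (restrict x {})"
  have "finite ?D"
    by (rule finite_subset[of _ "Pow {1..l}"]) auto
  \<comment> \<open>Bounding \<open>Min\<close> from below requires a nonempty finite set;
    \<open>d \<le> l\<close> provides a \<open>d\<close>-subset.\<close>
  moreover have "?D \<noteq> {}"
    using assms(4) obtain_subset_with_card_n[of d "{1..l}"] by auto
  ultimately show "Min ((\<lambda>a. marginal l I n a (restrict x a)) ` ?D)
      \<ge> marginal l I n {1..l} (restrict x {1..l})"
    unfolding marginal_full[OF x] using cell_le_marginal[OF ct x] by simp
  \<comment> \<open>Applied with \<open>k = ?K\<close> and \<open>c = l choose d\<close>; by
    Pascal's rule \<open>c - k\<close> is then \<open>(l - 1) choose d\<close>.\<close>
  have rearrange: "1 / k * s - (c / k - 1) * t \<le> m"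
    if "k > 0" "s \<le> k * m + (c - k) * t" for k s c t m :: real
    using that by (simp add: field_simps)
  have K: "?K > 0"
    using assms(3,4) by simp
  have "?sum \<le> ?K * n x + real ((l - 1) choose d) * ?total"
    by (rule sum_marginals_le[OF ct x assms(3,4)])
  also have "real ((l - 1) choose d) = real (l choose d) - ?K"
    using choose_reduce_nat[of l d] assms(3,4) by simp
  finally have "1 / ?K * ?sum - (real (l choose d) / ?K - 1) * ?total \<le> n x"
    using K by (intro rearrange)
  moreover have "0 \<le> n x"
    using ct x by (simp add: contingency_table_def)
  ultimately show "marginal l I n {1..l} (restrict x {1..l})
      \<ge> max (1 / ?K * ?sum - (real (l choose d) / ?K - 1) * ?total) 0"
    unfolding marginal_full[OF x] by (rule max.boundedI)
qed

end
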